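(* Let $\alpha\in\mathbb{R}$ with $-\pi/2<\alpha<\pi/2$, and let $f\in\mathcal{S}_{\alpha}$. Then the Schwarzian derivative $S_f$ satisfies the following inequalities. (i) If $|\alpha|\le \pi/6$ and $z\in\mathbb{D}$, then $$|S_f(z)|\le \frac{2\cos\alpha\,\bigl(1-(1-|z|^2)\sin|\alpha|\bigr)}{(1-|z|^2)^2(1-\sin|\alpha|)}.$$ (ii) If $|\alpha|>\pi/6$ and $z\in\mathbb{D}$, then $$|S_f(z)|\le \begin{cases} \dfrac{2\cos\alpha\,\bigl(1-(1-|z|^2)\sin|\alpha|\bigr)}{(1-|z|^2)^2(1-\sin|\alpha|)} & \text{for } |z|<\delta,\\[3mm] \dfrac{2\cos\alpha\,\sin|\alpha|}{(1-|z|)^2} & \text{for } |z|\ge\delta, \end{cases} $$ where $$\delta=\frac{1-\sin|\alpha|}{\sin|\alpha|}.$$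
   Context: $\mathbb{D}=\{z\in\mathbb{C}:|z|<1\}$ is the open unit disk. $\mathcal{A}$ denotes the class of analytic functions $f:\mathbb{D}\to\mathbb{C}$ normalized by $f(0)=0$ and $f'(0)=1$. For $-\pi/2<\alpha<\pi/2$, the Robertson class $\mathcal{S}_{\alpha}$ is the set of $f\in\mathcal{A}$ that are locally univalent (i.e. $f'(z)\neq 0$ for all $z\in\mathbb{D}$) and satisfy $$\operatorname{Re}\left\{e^{i\alpha}\left(1+\frac{zf''(z)}{f'(z)}\right)\right\}>0\quad\text{for all } z\in\mathbb{D}.$$ For a locally univalent analytic function $f$ on $\mathbb{D}$, the Schwarzian derivative is $$S_f(z)=\left(\frac{f''(z)}{f'(z)}\right)'-\frac12\left(\frac{f''(z)}{f'(z)}\right)^2 .$$ *)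

theory Defs
  imports "HOL-Complex_Analysis.Complex_Analysis"
begin

abbreviation unit_disk :: "complex set" where
  "unit_disk \<equiv> ball 0 1"

text \<open>Functions on the disk are total functions on \<^typ>\<open>complex\<close>; their values outside the disk
  are unconstrained and do not affect derivatives at points of the (open) disk.\<close>

definition normalized_analytic :: "(complex \<Rightarrow> complex) set" where
  "normalized_analytic = {f. f holomorphic_on unit_disk \<and> f 0 = 0 \<and> deriv f 0 = 1}"

definition locally_univalent :: "(complex \<Rightarrow> complex) \<Rightarrow> bool" where
  "locally_univalent f \<longleftrightarrow> (\<forall>z\<in>unit_disk. deriv f z \<noteq> 0)"

definition robertson_class :: "real \<Rightarrow> (complex \<Rightarrow> complex) set" where
  "robertson_class \<alpha> =
     {f \<in> normalized_analytic. locally_univalent f \<and>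
        (\<forall>z\<in>unit_disk.
           Re (exp (\<i> * of_real \<alpha>) * (1 + z * deriv (deriv f) z / deriv f z)) > 0)}"

definition schwarzian :: "(complex \<Rightarrow> complex) \<Rightarrow> complex \<Rightarrow> complex" where
  "schwarzian f z =
     deriv (\<lambda>w. deriv (deriv f) w / deriv f w) z - 1 / 2 * (deriv (deriv f) z / deriv f z)\<^sup>2"

end

theory Submission
  imports Defs
begin

text \<open>
  Put \<open>c = cos \<alpha> * exp (- \<i> * \<alpha>)\<close>. The condition defining the Robertson class says that
  \<open>exp (\<i> * \<alpha>) * (1 + z * f'' / f')\<close> maps the disk into the right half-plane, with value
  \<open>exp (\<i> * \<alpha>)\<close> at the origin. A Cayley transform taking that value to \<open>0\<close> turns this function into
  a self-map of the disk fixing the origin, which by the Schwarz lemma has the form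
  \<open>z * \<phi> z\<close> with \<open>\<phi>\<close> holomorphic and bounded by \<open>1\<close>; solving back,
  \<open>f'' / f' = 2 * c * \<phi> / (1 - z * \<phi>)\<close> (\<open>robertson_class_schwarz_function\<close>).

  Differentiating, the Schwarzian derivative becomes
  \<open>2 * c * (\<phi>' + (1 - c) * \<phi>\<^sup>2) / (1 - z * \<phi>)\<^sup>2\<close>, where \<open>\<bar>c\<bar> = cos \<alpha>\<close> and
  \<open>\<bar>1 - c\<bar> = sin \<bar>\<alpha>\<bar>\<close>. With the Schwarz--Pick inequality for \<open>\<phi>'\<close> and the triangle
  inequality, everything is estimated by the two real numbers \<open>r = \<bar>z\<bar>\<close> and \<open>x = \<bar>\<phi> z\<bar>\<close>
  (\<open>robertson_schwarzian_le\<close>): what remains is to maximise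
  \<open>(1 - k * x\<^sup>2) / (1 - r * x)\<^sup>2\<close> over \<open>0 \<le> x \<le> 1\<close>, where \<open>k = 1 - (1 - r\<^sup>2) * sin \<bar>\<alpha>\<bar>\<close>.

  The critical point of this quotient is \<open>x = r / k\<close>, and the value there is the first of the two
  bounds. It is therefore valid on the whole disk and for all \<open>\<alpha>\<close>. When \<open>k \<le> r\<close> the critical
  point leaves the interval \<open>[0, 1)\<close>, and the maximum is taken at \<open>x = 1\<close>; that gives the second
  bound. Since \<open>r - k = (1 - r) * (sin \<bar>\<alpha>\<bar> * (1 + r) - 1)\<close>, the condition \<open>k \<le> r\<close> is exactly
  \<open>\<delta> \<le> r\<close>. The angle \<open>\<pi> / 6\<close> is where \<open>\<delta>\<close> reaches \<open>1\<close>: below it the second bound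
  never comes into force.
\<close>

section \<open>The Schwarz--Pick inequality\<close>

lemma one_minus_cnj_mult_nonzero:
  assumes "norm w < 1" "norm z \<le> 1"
  shows "1 - cnj w * z \<noteq> 0"
proof
  assume "1 - cnj w * z = 0"
  then have "norm (cnj w * z) = 1" by (metis eq_iff_diff_eq_0 norm_one)
  moreover have "norm (cnj w * z) \<le> norm w"
    using assms mult_left_le[of "norm z" "norm w"] by (simp add: norm_mult)
  ultimately show False using assms by simp
qed

text \<open>At \<open>z = 0\<close> and \<open>z = w\<close> this gives \<open>1 - \<bar>w\<bar>\<^sup>2\<close> and \<open>1 / (1 - \<bar>w\<bar>\<^sup>2)\<close>, the two factors
  by which the Schwarz--Pick inequality differs from the Schwarz lemma.\<close>
lemma Moebius_function_has_field_derivative: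
  assumes "norm w < 1" "norm z \<le> 1"
  shows "(Moebius_function 0 w has_field_derivative
           of_real (1 - (norm w)\<^sup>2) / (1 - cnj w * z)\<^sup>2) (at z)"
proof -
  have nz: "1 - cnj w * z \<noteq> 0" by (rule one_minus_cnj_mult_nonzero) fact+
  have "((\<lambda>z. (z - w) / (1 - cnj w * z)) has_field_derivative
          (1 * (1 - cnj w * z) - (z - w) * (- cnj w)) / ((1 - cnj w * z) * (1 - cnj w * z))) (at z)"
    by (rule DERIV_divide) (use nz in \<open>auto intro!: derivative_eq_intros\<close>)
  moreover have "1 * (1 - cnj w * z) - (z - w) * (- cnj w) = of_real (1 - (norm w)\<^sup>2)"
    by (simp add: complex_norm_square algebra_simps del: of_real_power)
  moreover have "Moebius_function 0 w = (\<lambda>z. (z - w) / (1 - cnj w * z))"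
    by (simp add: fun_eq_iff Moebius_function_simple)
  ultimately show ?thesis by (simp only: power2_eq_square)
qed

text \<open>Disk automorphisms move \<open>z\<close> and \<open>f z\<close> to the origin, where the derivative bound of the
  Schwarz lemma applies; the chain rule brings in the derivatives of the automorphisms.\<close>
lemma Schwarz_Pick:
  assumes holf: "f holomorphic_on ball 0 1"
    and f1: "\<And>w. norm w < 1 \<Longrightarrow> norm (f w) < 1"
    and z: "norm z < 1"
  shows "norm (deriv f z) * (1 - (norm z)\<^sup>2) \<le> 1 - (norm (f z))\<^sup>2"
proof -
  define M where "M = Moebius_function 0 (- z)"
  define N where "N = Moebius_function 0 (f z)"
  have fz: "norm (f z) < 1" and nz: "norm (- z) < 1" using f1 z by auto
  have M0: "M 0 = z" by (simp add: M_def Moebius_function_simple)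
  have M1: "norm (M w) < 1" if "norm w < 1" for w
    unfolding M_def using Moebius_function_norm_lt_1[OF nz that] .
  have N1: "norm (N w) < 1" if "norm w < 1" for w
    unfolding N_def using Moebius_function_norm_lt_1[OF fz that] .
  have "f \<circ> M holomorphic_on ball 0 1"
    by (rule holomorphic_on_compose_gen[OF _ holf])
       (use M1 Moebius_function_holomorphic[OF nz] in \<open>auto simp: M_def\<close>)
  then have hol: "N \<circ> (f \<circ> M) holomorphic_on ball 0 1"
    by (rule holomorphic_on_compose_gen)
       (use M1 f1 Moebius_function_holomorphic[OF fz] in \<open>auto simp: N_def\<close>)
  have dM: "(M has_field_derivative of_real (1 - (norm z)\<^sup>2)) (at 0)"
    using Moebius_function_has_field_derivative[OF nz, of 0] by (simp add: M_def)
  have df: "(f has_field_derivative deriv f z) (at (M 0))"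
    using holomorphic_derivI[OF holf, of z] z M0 by simp
  have dN: "(N has_field_derivative
      of_real (1 - (norm (f z))\<^sup>2) / (1 - cnj (f z) * f z)\<^sup>2) (at ((f \<circ> M) 0))"
    using Moebius_function_has_field_derivative[OF fz, of "f z"] fz by (simp add: M0 N_def)
  define q where "q = 1 - (norm (f z))\<^sup>2"
  have q: "q > 0" using fz by (simp add: q_def abs_square_less_1)
  have "1 - cnj (f z) * f z = of_real q"
    by (simp add: q_def complex_norm_square mult.commute del: of_real_power)
  then have "deriv (N \<circ> (f \<circ> M)) 0 =
      of_real q / (of_real q)\<^sup>2 * (deriv f z * of_real (1 - (norm z)\<^sup>2))"
    using DERIV_imp_deriv[OF DERIV_chain[OF dN DERIV_chain[OF df dM]]] by (simp add: q_def)
  moreover have "norm (deriv (N \<circ> (f \<circ> M)) 0) \<le> 1"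
    by (rule Schwarz_Lemma(2)[OF hol, of 0])
       (use M1 N1 f1 in \<open>auto simp: M0 N_def Moebius_function_eq_zero\<close>)
  moreover have "norm (of_real (1 - (norm z)\<^sup>2) :: complex) = 1 - (norm z)\<^sup>2"
    using z by (simp add: norm_of_real abs_square_le_1 del: of_real_diff)
  ultimately have "norm (deriv f z) * (1 - (norm z)\<^sup>2) / q \<le> 1"
    using q by (simp add: norm_mult norm_divide power2_eq_square[of "of_real q"] del: of_real_diff)
  then show ?thesis using q by (simp add: q_def[symmetric] divide_simps)
qed

text \<open>The function \<open>\<phi>\<close> of the main argument may be a constant of modulus \<open>1\<close> (it is for the
  extremal functions of the second bound), so maps into the closed disk must be covered. They are
  limits of the maps \<open>t * f\<close> into the open disk as \<open>t\<close> increases to \<open>1\<close>.\<close>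
lemma Schwarz_Pick_closed:
  assumes holf: "f holomorphic_on ball 0 1"
    and f1: "\<And>w. norm w < 1 \<Longrightarrow> norm (f w) \<le> 1"
    and z: "norm z < 1"
  shows "norm (deriv f z) * (1 - (norm z)\<^sup>2) \<le> 1 - (norm (f z))\<^sup>2"
proof -
  have scaled: "t * norm (deriv f z) * (1 - (norm z)\<^sup>2) \<le> 1 - (t * norm (f z))\<^sup>2"
    if t: "0 < t" "t < 1" for t :: real
  proof -
    have "norm (of_real t * f w) < 1" if "norm w < 1" for w
    proof -
      have "t * norm (f w) \<le> t" using f1[OF that] t by (simp add: mult_left_le)
      then have "t * norm (f w) < 1" using t by linarith
      then show ?thesis using t by (simp add: norm_mult)
    qed
    moreover have "(\<lambda>w. of_real t * f w) holomorphic_on ball 0 1"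
      by (intro holomorphic_intros holf)
    ultimately have "norm (deriv (\<lambda>w. of_real t * f w) z) * (1 - (norm z)\<^sup>2)
        \<le> 1 - (norm (of_real t * f z))\<^sup>2"
      using z by (intro Schwarz_Pick) auto
    moreover have "deriv (\<lambda>w. of_real t * f w) z = of_real t * deriv f z"
      by (rule DERIV_imp_deriv, rule DERIV_cmult, rule holomorphic_derivI[OF holf]) (use z in auto)
    ultimately show ?thesis using t by (simp add: norm_mult)
  qed
  show ?thesis
  proof (rule tendsto_le[of "at_left (1::real)"])
    show "((\<lambda>t. 1 - (t * norm (f z))\<^sup>2) \<longlongrightarrow> 1 - (norm (f z))\<^sup>2) (at_left 1)"
      by (auto intro!: tendsto_eq_intros)
    show "((\<lambda>t. t * norm (deriv f z) * (1 - (norm z)\<^sup>2)) \<longlongrightarrow> norm (deriv f z) * (1 - (norm z)\<^sup>2))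
        (at_left 1)"
      by (auto intro!: tendsto_eq_intros)
    show "\<forall>\<^sub>F t in at_left 1. t * norm (deriv f z) * (1 - (norm z)\<^sup>2) \<le> 1 - (t * norm (f z))\<^sup>2"
      using eventually_at_left_real[of 0 "1::real"] scaled by (auto elim!: eventually_mono)
  qed auto
qed

section \<open>An extremal problem in one real variable\<close>

text \<open>The right-hand side is the value at the critical point \<open>x = r / k\<close>; after clearing
  denominators the two sides differ by the square \<open>(k * x - r)\<^sup>2\<close>.\<close>
lemma one_minus_square_quotient_le:
  fixes k r x :: real
  assumes "r\<^sup>2 < k" "r * x < 1"
  shows "(1 - k * x\<^sup>2) / (1 - r * x)\<^sup>2 \<le> k / (k - r\<^sup>2)"
proof -
  have "k * (1 - r * x)\<^sup>2 - (1 - k * x\<^sup>2) * (k - r\<^sup>2) = (k * x - r)\<^sup>2"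
    by (simp add: algebra_simps power2_eq_square)
  then have "(1 - k * x\<^sup>2) * (k - r\<^sup>2) \<le> k * (1 - r * x)\<^sup>2"
    by (metis diff_ge_0_iff_ge zero_le_power2)
  then show ?thesis using assms by (simp add: divide_simps)
qed

text \<open>For \<open>k \<le> r\<close> the quotient increases on \<open>[0, 1]\<close>, so that its value at \<open>x = 1\<close> dominates.\<close>
lemma one_minus_square_quotient_le_at_1:
  fixes k r x :: real
  assumes "0 \<le> k" "k \<le> r" "r < 1" "x \<le> 1"
  shows "(1 - k * x\<^sup>2) / (1 - r * x)\<^sup>2 \<le> (1 - k) / (1 - r)\<^sup>2"
proof -
  have rx: "r * x < 1"
    using assms by (metis mult_left_le le_less_trans order_trans)
  \<comment> \<open>After clearing denominators the difference of the two sides vanishes at \<open>x = 1\<close>; \<open>d\<close> is its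
    quotient by \<open>1 - x\<close>, which is affine in \<open>x\<close>.\<close>
  define d where "d = (1 - k) * r * (2 - r - r * x) - k * (1 + x) * (1 - r)\<^sup>2"
  have "d = 2 * (1 - r) * (r - k) + (1 - x) * ((1 - k) * r\<^sup>2 + k * (1 - r)\<^sup>2)"
    by (simp add: d_def algebra_simps power2_eq_square)
  then have "0 \<le> d" using assms by simp
  then have "0 \<le> (1 - x) * d" using assms by simp
  also have "\<dots> = (1 - k) * (1 - r * x)\<^sup>2 - (1 - k * x\<^sup>2) * (1 - r)\<^sup>2"
    by (simp add: d_def algebra_simps power2_eq_square)
  finally show ?thesis using assms rx by (simp add: divide_simps)
qed

section \<open>The Schwarzian derivative of a Robertson function\<close>

text \<open>The point \<open>- cnj u\<close> is the mirror image of \<open>u\<close> in the imaginary axis, and points of the right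
  half-plane are closer to \<open>u\<close> than to its mirror image. Hence \<open>(w - u) / (w + cnj u)\<close> is the
  Cayley transform that takes \<open>u\<close> to \<open>0\<close>.\<close>
lemma norm_minus_reflection_less:
  fixes u w :: complex
  assumes "0 < Re u" "0 < Re w"
  shows "norm (w - u) < norm (w + cnj u)"
proof -
  have "(norm (w - u))\<^sup>2 < (norm (w + cnj u))\<^sup>2"
    using mult_pos_pos[OF assms] unfolding cmod_power2
    by (simp add: power2_eq_square algebra_simps)
  then show ?thesis by (rule power2_less_imp_less) simp
qed

definition robertson_const :: "real \<Rightarrow> complex" where
  "robertson_const \<alpha> = of_real (cos \<alpha>) * exp (- (\<i> * of_real \<alpha>))"

lemma norm_robertson_const: "norm (robertson_const \<alpha>) = \<bar>cos \<alpha>\<bar>"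
  by (simp add: robertson_const_def norm_mult norm_exp_eq_Re)

text \<open>With \<open>u = exp (\<i> * \<alpha>)\<close> this reads \<open>u * (2 * c) = u + cnj u\<close>. It identifies
  \<open>2 * c + z * f'' / f'\<close>, up to the factor \<open>u\<close>, with the denominator of the Cayley transform.\<close>
lemma exp_mult_two_robertson_const:
  "exp (\<i> * of_real \<alpha>) * (2 * robertson_const \<alpha>)
     = exp (\<i> * of_real \<alpha>) + exp (- (\<i> * of_real \<alpha>))"
proof -
  have "exp (\<i> * of_real \<alpha>) * (2 * robertson_const \<alpha>) = 2 * of_real (cos \<alpha>)"
    by (simp add: robertson_const_def exp_minus)
  also have "\<dots> = exp (\<i> * of_real \<alpha>) + exp (- (\<i> * of_real \<alpha>))"
    by (simp add: cos_of_real[symmetric] cos_exp_eq)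
  finally show ?thesis .
qed

text \<open>The numbers \<open>0\<close>, \<open>c\<close>, \<open>1\<close> form a triangle with a right angle at \<open>c\<close>: the point \<open>c\<close> is the
  orthogonal projection of \<open>1\<close> to the line spanned by \<open>exp (- \<i> * \<alpha>)\<close>.\<close>
lemma norm_one_minus_robertson_const: "norm (1 - robertson_const \<alpha>) = \<bar>sin \<alpha>\<bar>"
proof -
  have "exp (- (\<i> * of_real \<alpha>)) = cis (- \<alpha>)" by (simp add: cis_conv_exp)
  then have "1 - robertson_const \<alpha> = of_real (sin \<alpha>) * \<i> * cis (- \<alpha>)"
    using sin_cos_squared_add[of \<alpha>]
    by (auto simp: robertson_const_def complex_eq_iff power2_eq_square)
  then show ?thesis by (simp add: norm_mult)
qed

text \<open>The Cayley transform of \<open>exp (\<i> * \<alpha>) * (1 + z * f'' / f')\<close> has the explicit form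
  \<open>z * P z / (2 * c + z * P z)\<close> with \<open>P = f'' / f'\<close>. The factor \<open>z\<close> is thus visible, and \<open>\<phi>\<close>
  can be written down without removing a singularity at the origin.\<close>
lemma robertson_class_schwarz_function:
  assumes \<alpha>: "- pi / 2 < \<alpha>" "\<alpha> < pi / 2" and f: "f \<in> robertson_class \<alpha>"
  obtains \<phi> where "\<phi> holomorphic_on unit_disk"
    and "\<And>z. norm z < 1 \<Longrightarrow> norm (\<phi> z) \<le> 1"
    and "\<And>z. norm z < 1 \<Longrightarrow>
           deriv (deriv f) z / deriv f z = 2 * robertson_const \<alpha> * \<phi> z / (1 - z * \<phi> z)"
proof -
  define c where "c = robertson_const \<alpha>"
  define u where "u = exp (\<i> * of_real \<alpha>)"
  define P where "P = (\<lambda>z. deriv (deriv f) z / deriv f z)"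
  define \<phi> where "\<phi> = (\<lambda>z. P z / (2 * c + z * P z))"
  have cos_pos: "0 < cos \<alpha>" using \<alpha> by (simp add: cos_gt_zero_pi)
  have u: "u \<noteq> 0" "Re u = cos \<alpha>" "cnj u = exp (- (\<i> * of_real \<alpha>))"
    by (simp_all add: u_def Re_exp exp_cnj)
  have c0: "c \<noteq> 0" using norm_robertson_const[of \<alpha>] cos_pos by (auto simp: c_def)
  have hol: "f holomorphic_on unit_disk"
    and f': "\<And>z. norm z < 1 \<Longrightarrow> deriv f z \<noteq> 0"
    and Re_pos: "\<And>z. norm z < 1 \<Longrightarrow> 0 < Re (u * (1 + z * P z))"
    using f by (auto simp: robertson_class_def normalized_analytic_def locally_univalent_def
        u_def P_def)
  have num: "u * (z * P z) = u * (1 + z * P z) - u" for z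
    by (simp add: algebra_simps)
  have den: "u * (2 * c + z * P z) = u * (1 + z * P z) + cnj u" for z
    using exp_mult_two_robertson_const[of \<alpha>, folded u_def u(3) c_def]
    by (simp add: distrib_left)
  have less: "norm (z * P z) < norm (2 * c + z * P z)" if "norm z < 1" for z
  proof -
    have "norm (u * (z * P z)) < norm (u * (2 * c + z * P z))"
      unfolding num den
      using Re_pos[OF that] cos_pos u(2) by (intro norm_minus_reflection_less) auto
    then show ?thesis using u(1) by (simp add: norm_mult del: mult_less_cancel_left)
  qed
  then have den0: "2 * c + z * P z \<noteq> 0" if "norm z < 1" for z
    using that by (metis norm_zero norm_ge_zero not_less)
  have holP: "P holomorphic_on unit_disk"
    unfolding P_def by (intro holomorphic_intros hol holomorphic_deriv) (use f' in auto)
  have hol\<phi>: "\<phi> holomorphic_on unit_disk"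
    unfolding \<phi>_def by (intro holomorphic_intros holP) (use den0 in auto)
  have lt1: "norm (z * \<phi> z) < 1" if "norm z < 1" for z
    using less[OF that] den0[OF that] by (simp add: \<phi>_def norm_divide divide_simps)
  have hol\<omega>: "(\<lambda>z. z * \<phi> z) holomorphic_on unit_disk"
    by (intro holomorphic_intros hol\<phi>)
  have "norm (\<phi> z) \<le> 1" if z: "norm z < 1" for z
  proof (cases "z = 0")
    case True
    have "((\<lambda>z. z * \<phi> z) has_field_derivative \<phi> 0) (at 0)"
      using holomorphic_derivI[OF hol\<phi>, of 0] by (auto intro!: derivative_eq_intros)
    then have "deriv (\<lambda>z. z * \<phi> z) 0 = \<phi> 0" by (rule DERIV_imp_deriv)
    then show ?thesis using Schwarz_Lemma(2)[OF hol\<omega> _ lt1 z] True by simp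
  next
    case False
    then show ?thesis using Schwarz_Lemma(1)[OF hol\<omega> _ lt1 z] by (simp add: norm_mult)
  qed
  moreover have "P z = 2 * c * \<phi> z / (1 - z * \<phi> z)" if "norm z < 1" for z
  proof -
    have "1 - z * \<phi> z = 2 * c / (2 * c + z * P z)"
      using den0[OF that] by (simp add: \<phi>_def divide_simps)
    then show ?thesis using den0[OF that] c0 by (simp add: \<phi>_def)
  qed
  ultimately show thesis using that hol\<phi> by (simp add: P_def c_def)
qed

text \<open>The terms \<open>z * \<phi> * \<phi>'\<close> from the quotient rule cancel, and the square subtracted in the
  Schwarzian derivative only changes the coefficient of \<open>\<phi>\<^sup>2\<close> from \<open>1\<close> to \<open>1 - c\<close>.\<close>
lemma schwarzian_of_schwarz_function:
  assumes hol: "\<phi> holomorphic_on unit_disk"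
    and \<phi>1: "\<And>z. norm z < 1 \<Longrightarrow> norm (\<phi> z) \<le> 1"
    and P: "\<And>z. norm z < 1 \<Longrightarrow> deriv (deriv f) z / deriv f z = 2 * c * \<phi> z / (1 - z * \<phi> z)"
    and z: "norm z < 1"
  shows "schwarzian f z = 2 * c * (deriv \<phi> z + (1 - c) * (\<phi> z)\<^sup>2) / (1 - z * \<phi> z)\<^sup>2"
proof -
  have nz: "1 - z * \<phi> z \<noteq> 0"
    using one_minus_cnj_mult_nonzero[of "cnj z" "\<phi> z"] z \<phi>1 by simp
  have d\<phi>: "(\<phi> has_field_derivative deriv \<phi> z) (at z)"
    using holomorphic_derivI[OF hol] z by simp
  have "((\<lambda>w. 2 * c * \<phi> w / (1 - w * \<phi> w)) has_field_derivative
      2 * c * (deriv \<phi> z + (\<phi> z)\<^sup>2) / (1 - z * \<phi> z)\<^sup>2) (at z)"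
    using nz by (auto intro!: derivative_eq_intros d\<phi> simp: power2_eq_square field_simps)
  moreover have "\<forall>\<^sub>F w in nhds z. w \<in> unit_disk"
    using z by (intro eventually_nhds_in_open) auto
  then have "\<forall>\<^sub>F w in nhds z. deriv (deriv f) w / deriv f w = 2 * c * \<phi> w / (1 - w * \<phi> w)"
    by eventually_elim (use P in auto)
  then have "deriv (\<lambda>w. deriv (deriv f) w / deriv f w) z
      = deriv (\<lambda>w. 2 * c * \<phi> w / (1 - w * \<phi> w)) z"
    by (rule deriv_cong_ev) simp
  ultimately have "schwarzian f z = 2 * c * (deriv \<phi> z + (\<phi> z)\<^sup>2) / (1 - z * \<phi> z)\<^sup>2
      - 1 / 2 * (2 * c * \<phi> z / (1 - z * \<phi> z))\<^sup>2"
    using z by (simp add: schwarzian_def P DERIV_imp_deriv)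
  also have "\<dots> = 2 * c * (deriv \<phi> z + (1 - c) * (\<phi> z)\<^sup>2) / (1 - z * \<phi> z)\<^sup>2"
    by (simp add: power_divide power_mult_distrib diff_divide_distrib[symmetric])
       (simp add: algebra_simps power2_eq_square)
  finally show ?thesis .
qed

text \<open>The number \<open>x\<close> is \<open>\<bar>\<phi> z\<bar>\<close>, the only datum of \<open>f\<close> on which the estimate depends.\<close>
lemma robertson_schwarzian_le:
  assumes \<alpha>: "- pi / 2 < \<alpha>" "\<alpha> < pi / 2" and f: "f \<in> robertson_class \<alpha>"
    and z: "norm z < 1"
  obtains x where "0 \<le> x" "x \<le> 1"
    "norm (schwarzian f z) \<le> 2 * cos \<alpha> / (1 - (norm z)\<^sup>2) *
       ((1 - (1 - (1 - (norm z)\<^sup>2) * sin \<bar>\<alpha>\<bar>) * x\<^sup>2) / (1 - norm z * x)\<^sup>2)"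
proof -
  obtain \<phi> where hol: "\<phi> holomorphic_on unit_disk"
    and \<phi>1: "\<And>z. norm z < 1 \<Longrightarrow> norm (\<phi> z) \<le> 1"
    and P: "\<And>z. norm z < 1 \<Longrightarrow>
           deriv (deriv f) z / deriv f z = 2 * robertson_const \<alpha> * \<phi> z / (1 - z * \<phi> z)"
    using robertson_class_schwarz_function[OF \<alpha> f] by blast
  define x where "x = norm (\<phi> z)"
  define r where "r = norm z"
  define s where "s = sin \<bar>\<alpha>\<bar>"
  have x: "0 \<le> x" "x \<le> 1" using \<phi>1 z by (auto simp: x_def)
  have r: "0 \<le> r" "r < 1" using z by (auto simp: r_def)
  have r2: "0 < 1 - r\<^sup>2" using r by (simp add: abs_square_less_1)
  have cos_pos: "0 < cos \<alpha>" using \<alpha> by (simp add: cos_gt_zero_pi)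
  have s: "norm (1 - robertson_const \<alpha>) = s"
    using \<alpha> sin_ge_zero[of "\<bar>\<alpha>\<bar>"] by (auto simp: norm_one_minus_robertson_const s_def abs_if)
  have "norm (deriv \<phi> z) \<le> (1 - x\<^sup>2) / (1 - r\<^sup>2)"
    using Schwarz_Pick_closed[OF hol \<phi>1 z] r2 by (simp add: x_def r_def field_simps)
  moreover have "norm (deriv \<phi> z + (1 - robertson_const \<alpha>) * (\<phi> z)\<^sup>2) \<le> norm (deriv \<phi> z) + s * x\<^sup>2"
    by (rule norm_triangle_le) (simp add: norm_mult s x_def norm_power)
  ultimately have num: "norm (deriv \<phi> z + (1 - robertson_const \<alpha>) * (\<phi> z)\<^sup>2)
      \<le> (1 - x\<^sup>2) / (1 - r\<^sup>2) + s * x\<^sup>2" by linarith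
  have "r * x \<le> r" using r x by (simp add: mult_left_le)
  then have rx: "0 < 1 - r * x" using r by linarith
  have "1 - r * x \<le> norm (1 - z * \<phi> z)"
    using norm_triangle_ineq2[of 1 "z * \<phi> z"] by (simp add: norm_mult r_def x_def)
  then have den: "(1 - r * x)\<^sup>2 \<le> (norm (1 - z * \<phi> z))\<^sup>2"
    using rx by (intro power_mono) auto
  have "norm (schwarzian f z) = 2 * cos \<alpha> *
      (norm (deriv \<phi> z + (1 - robertson_const \<alpha>) * (\<phi> z)\<^sup>2) / (norm (1 - z * \<phi> z))\<^sup>2)"
    using cos_pos by (simp add: schwarzian_of_schwarz_function[OF hol \<phi>1 P z] norm_mult norm_divide norm_power
        norm_robertson_const)
  also have "\<dots> \<le> 2 * cos \<alpha> * (((1 - x\<^sup>2) / (1 - r\<^sup>2) + s * x\<^sup>2) / (1 - r * x)\<^sup>2)"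
    using num den rx cos_pos by (intro mult_left_mono frac_le) (auto intro: order_trans[OF norm_ge_zero])
  also have "(1 - x\<^sup>2) / (1 - r\<^sup>2) + s * x\<^sup>2 = (1 - (1 - (1 - r\<^sup>2) * s) * x\<^sup>2) / (1 - r\<^sup>2)"
    using r2 by (simp add: field_simps)
  finally show thesis using that[OF x] by (simp add: r_def s_def mult.commute)
qed

theorem theorem2p1:
  fixes \<alpha> :: real and f :: "complex \<Rightarrow> complex"
  assumes "- pi / 2 < \<alpha>" and "\<alpha> < pi / 2"
    and "f \<in> robertson_class \<alpha>"
  shows "(\<bar>\<alpha>\<bar> \<le> pi / 6 \<longrightarrow>
           (\<forall>z\<in>unit_disk.
              norm (schwarzian f z)
                \<le> 2 * cos \<alpha> * (1 - (1 - (norm z)\<^sup>2) * sin \<bar>\<alpha>\<bar>)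
                    / ((1 - (norm z)\<^sup>2)\<^sup>2 * (1 - sin \<bar>\<alpha>\<bar>))))
       \<and> (\<bar>\<alpha>\<bar> > pi / 6 \<longrightarrow>
           (let \<delta> = (1 - sin \<bar>\<alpha>\<bar>) / sin \<bar>\<alpha>\<bar> in
            \<forall>z\<in>unit_disk.
              norm (schwarzian f z)
                \<le> (if norm z < \<delta>
                    then 2 * cos \<alpha> * (1 - (1 - (norm z)\<^sup>2) * sin \<bar>\<alpha>\<bar>)
                           / ((1 - (norm z)\<^sup>2)\<^sup>2 * (1 - sin \<bar>\<alpha>\<bar>))
                    else 2 * cos \<alpha> * sin \<bar>\<alpha>\<bar> / (1 - norm z)\<^sup>2)))"
proof -
  define s where "s = sin \<bar>\<alpha>\<bar>"
  have cos_pos: "0 < cos \<alpha>" using assms by (simp add: cos_gt_zero_pi)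
  have s0: "0 \<le> s" unfolding s_def using assms by (intro sin_ge_zero) auto
  have s1: "s < 1"
    unfolding s_def using sin_monotone_2pi[of "\<bar>\<alpha>\<bar>" "pi / 2"] assms by (auto simp: abs_if)
  \<comment> \<open>The value at the critical point \<open>x = r / k\<close>, an upper bound wherever that point lies.\<close>
  have interior: "norm (schwarzian f z)
      \<le> 2 * cos \<alpha> * (1 - (1 - (norm z)\<^sup>2) * s) / ((1 - (norm z)\<^sup>2)\<^sup>2 * (1 - s))"
    if z: "norm z < 1" for z
  proof -
    obtain x where x: "0 \<le> x" "x \<le> 1"
      and le: "norm (schwarzian f z) \<le> 2 * cos \<alpha> / (1 - (norm z)\<^sup>2) *
         ((1 - (1 - (1 - (norm z)\<^sup>2) * s) * x\<^sup>2) / (1 - norm z * x)\<^sup>2)"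
      using robertson_schwarzian_le[OF assms z] unfolding s_def by blast
    define k where "k = 1 - (1 - (norm z)\<^sup>2) * s"
    have r2: "0 < 1 - (norm z)\<^sup>2" using z by (simp add: abs_square_less_1)
    have k: "k - (norm z)\<^sup>2 = (1 - (norm z)\<^sup>2) * (1 - s)" by (simp add: k_def algebra_simps)
    have "(norm z)\<^sup>2 < k" using k mult_pos_pos[OF r2, of "1 - s"] s1 by linarith
    moreover have "norm z * x < 1"
      using z x mult_left_le[of x "norm z"] by simp
    ultimately have "(1 - k * x\<^sup>2) / (1 - norm z * x)\<^sup>2 \<le> k / (k - (norm z)\<^sup>2)"
      by (rule one_minus_square_quotient_le)
    then have "2 * cos \<alpha> / (1 - (norm z)\<^sup>2) * ((1 - k * x\<^sup>2) / (1 - norm z * x)\<^sup>2)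
        \<le> 2 * cos \<alpha> / (1 - (norm z)\<^sup>2) * (k / (k - (norm z)\<^sup>2))"
      using cos_pos r2 by (intro mult_left_mono) auto
    then show ?thesis
      using le by (simp add: k k_def[symmetric] power2_eq_square[of "1 - (norm z)\<^sup>2"])
  qed
  \<comment> \<open>The value at the endpoint \<open>x = 1\<close>.\<close>
  have boundary: "norm (schwarzian f z) \<le> 2 * cos \<alpha> * s / (1 - norm z)\<^sup>2"
    if z: "norm z < 1" and "0 < s" and \<delta>: "(1 - s) / s \<le> norm z" for z
  proof -
    obtain x where x: "0 \<le> x" "x \<le> 1"
      and le: "norm (schwarzian f z) \<le> 2 * cos \<alpha> / (1 - (norm z)\<^sup>2) *
         ((1 - (1 - (1 - (norm z)\<^sup>2) * s) * x\<^sup>2) / (1 - norm z * x)\<^sup>2)"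
      using robertson_schwarzian_le[OF assms z] unfolding s_def by blast
    define k where "k = 1 - (1 - (norm z)\<^sup>2) * s"
    have r2: "0 < 1 - (norm z)\<^sup>2" using z by (simp add: abs_square_less_1)
    have "1 \<le> s * (1 + norm z)" using \<delta> \<open>0 < s\<close> by (simp add: field_simps)
    then have "(1 - norm z) * 1 \<le> (1 - norm z) * (s * (1 + norm z))"
      using z by (intro mult_left_mono) auto
    then have "k \<le> norm z" by (simp add: k_def algebra_simps power2_eq_square)
    moreover have "0 \<le> k"
      using mult_mono[of "1 - (norm z)\<^sup>2" 1 s 1] s0 s1 r2 by (simp add: k_def)
    ultimately have "(1 - k * x\<^sup>2) / (1 - norm z * x)\<^sup>2 \<le> (1 - k) / (1 - norm z)\<^sup>2"
      using z x by (intro one_minus_square_quotient_le_at_1) auto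
    then have "2 * cos \<alpha> / (1 - (norm z)\<^sup>2) * ((1 - k * x\<^sup>2) / (1 - norm z * x)\<^sup>2)
        \<le> 2 * cos \<alpha> / (1 - (norm z)\<^sup>2) * ((1 - k) / (1 - norm z)\<^sup>2)"
      using cos_pos r2 by (intro mult_left_mono) auto
    moreover have "1 - k = (1 - (norm z)\<^sup>2) * s" by (simp add: k_def)
    ultimately show ?thesis using le r2 by (simp add: k_def[symmetric])
  qed
  have "0 < s" if "\<bar>\<alpha>\<bar> > pi / 6"
  proof -
    have "0 < \<bar>\<alpha>\<bar>" using that pi_gt_zero by linarith
    moreover have "\<bar>\<alpha>\<bar> < pi" using assms pi_gt_zero by (auto simp: abs_if)
    ultimately show ?thesis unfolding s_def by (rule sin_gt_zero)
  qed
  then show ?thesis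
    using interior boundary unfolding s_def[symmetric] Let_def by auto
qed

end
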